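(* Let $0\le\lambda<n$ and $1\le p<\infty$. Every function in $V^{(\ast)}_{0,\infty}L^{p,\lambda}$ can be approximated in the norm $\|\cdot\|_{p,\lambda}$ by functions in $C_0^\infty(\mathbb{R}^n)$.
   Context: $B(x,r)$ is the open ball in $\mathbb{R}^n$ with center $x$ and radius $r$. For $f\in L^1_{\mathrm{loc}}(\mathbb{R}^n)$ let $\mathfrak{M}_{p,\lambda}(f;x,r):=r^{-\lambda}\int_{B(x,r)}|f(y)|^p\,dy$. The homogeneous Morrey space $L^{p,\lambda}(\mathbb{R}^n)$ consists of $f\in L^p_{\mathrm{loc}}(\mathbb{R}^n)$ with $\|f\|_{p,\lambda}:=\sup_{x\in\mathbb{R}^n,\,r>0}\mathfrak{M}_{p,\lambda}(f;x,r)^{1/p}<\infty$. Subsets of $L^{p,\lambda}$: $V_0L^{p,\lambda}=\{f:\lim_{r\to0}\sup_{x}\mathfrak{M}_{p,\lambda}(f;x,r)=0\}$; $V_\infty L^{p,\lambda}=\{f:\lim_{r\to\infty}\sup_{x}\mathfrak{M}_{p,\lambda}(f;x,r)=0\}$; $V^{(\ast)}L^{p,\lambda}=\{f:\lim_{N\to\infty}\sup_{x}\int_{B(x,1)}|f(y)|^p\chi_{\mathbb{R}^n\setminus B(0,N)}(y)\,dy=0\}$; $V^{(\ast)}_{0,\infty}L^{p,\lambda}:=V_0L^{p,\lambda}\cap V_\infty L^{p,\lambda}\cap V^{(\ast)}L^{p,\lambda}$. *)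

theory Defs
  imports "HOL-Analysis.Analysis"
begin

definition morrey_M :: "real \<Rightarrow> real \<Rightarrow> ('a::euclidean_space \<Rightarrow> real) \<Rightarrow> 'a \<Rightarrow> real \<Rightarrow> ennreal" where
  "morrey_M p lam f x r =
     ennreal (r powr (- lam)) * (\<integral>\<^sup>+ y \<in> ball x r. ennreal (\<bar>f y\<bar> powr p) \<partial>lborel)"

definition morrey_sup :: "real \<Rightarrow> real \<Rightarrow> ('a::euclidean_space \<Rightarrow> real) \<Rightarrow> ennreal" where
  "morrey_sup p lam f = (SUP (x, r) \<in> UNIV \<times> {0<..}. morrey_M p lam f x r)"

definition Lp_loc :: "real \<Rightarrow> ('a::euclidean_space \<Rightarrow> real) \<Rightarrow> bool" where
  "Lp_loc p f \<longleftrightarrow> f \<in> borel_measurable lebesgue \<and>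
     (\<forall>K. compact K \<longrightarrow> (\<integral>\<^sup>+ y \<in> K. ennreal (\<bar>f y\<bar> powr p) \<partial>lborel) < \<infinity>)"

definition morrey_space :: "real \<Rightarrow> real \<Rightarrow> ('a::euclidean_space \<Rightarrow> real) set" where
  "morrey_space p lam = {f. Lp_loc p f \<and> morrey_sup p lam f < \<infinity>}"

text \<open>The Morrey norm (meaningful for f in the Morrey space, where the sup is finite).\<close>
definition morrey_norm :: "real \<Rightarrow> real \<Rightarrow> ('a::euclidean_space \<Rightarrow> real) \<Rightarrow> real" where
  "morrey_norm p lam f = (enn2real (morrey_sup p lam f)) powr (1 / p)"

definition V0_morrey :: "real \<Rightarrow> real \<Rightarrow> ('a::euclidean_space \<Rightarrow> real) set" where
  "V0_morrey p lam = {f \<in> morrey_space p lam.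
     ((\<lambda>r. SUP x. morrey_M p lam f x r) \<longlongrightarrow> 0) (at_right 0)}"

definition Vinf_morrey :: "real \<Rightarrow> real \<Rightarrow> ('a::euclidean_space \<Rightarrow> real) set" where
  "Vinf_morrey p lam = {f \<in> morrey_space p lam.
     ((\<lambda>r. SUP x. morrey_M p lam f x r) \<longlongrightarrow> 0) at_top}"

definition Vstar_morrey :: "real \<Rightarrow> real \<Rightarrow> ('a::euclidean_space \<Rightarrow> real) set" where
  "Vstar_morrey p lam = {f \<in> morrey_space p lam.
     ((\<lambda>N::nat. SUP x. \<integral>\<^sup>+ y \<in> ball x 1.
          ennreal (\<bar>f y\<bar> powr p) * indicator (- ball 0 (real N)) y \<partial>lborel) \<longlonglongrightarrow> 0)}"

definition V0inf_star_morrey :: "real \<Rightarrow> real \<Rightarrow> ('a::euclidean_space \<Rightarrow> real) set" where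
  "V0inf_star_morrey p lam = V0_morrey p lam \<inter> Vinf_morrey p lam \<inter> Vstar_morrey p lam"

definition pdir :: "'a::euclidean_space \<Rightarrow> ('a \<Rightarrow> real) \<Rightarrow> 'a \<Rightarrow> real" where
  "pdir v g = (\<lambda>x. frechet_derivative g (at x) v)"

definition Cinf :: "('a::euclidean_space \<Rightarrow> real) \<Rightarrow> bool" where
  "Cinf f \<longleftrightarrow> (\<forall>ds. set ds \<subseteq> Basis \<longrightarrow>
      (\<forall>x. foldr pdir ds f differentiable (at x)))"

definition C0_inf :: "('a::euclidean_space \<Rightarrow> real) set" where
  "C0_inf = {g. Cinf g \<and> compact (closure {x. g x \<noteq> 0})}"

end

theory Submission
  imports Defs
begin

text \<open>
  Restricting \<open>f\<close> to a large ball changes it little in the Morrey norm: small radii are controlled by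
  the vanishing property at 0, large radii by the one at infinity, and intermediate radii by covering
  a ball with boundedly many unit balls. On a fixed ball no mollification is needed. If functions
  tend to 0 almost everywhere and are dominated by an \<open>L\<^sup>p\<close> function with the vanishing property at 0,
  then they tend to 0 in the Morrey norm, because the domination settles the small radii uniformly and
  ordinary dominated convergence the others. Now let \<open>\<beta>\<close> be a smooth bump function that is positive
  exactly on the ball. Truncating \<open>f / \<beta>\<close> reduces the problem to \<open>\<beta> k\<close> with \<open>k\<close> bounded; such a \<open>k\<close> is an
  almost everywhere limit of uniformly bounded polynomials \<open>P n\<close> on the ball, so \<open>\<beta> P n\<close> tends to \<open>\<beta> k\<close>
  dominated by a constant on the ball, which vanishes at 0 in the Morrey sense as \<open>lam < n\<close>.
\<close>

section \<open>Smooth functions\<close>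

lemma Cinf_coinduct [consumes 1, case_names differentiable pdir]:
  assumes "f \<in> X"
    and "\<And>g x. g \<in> X \<Longrightarrow> g differentiable (at x)"
    and "\<And>g b. g \<in> X \<Longrightarrow> b \<in> Basis \<Longrightarrow> pdir b g \<in> X"
  shows "Cinf f"
proof -
  have "foldr pdir ds f \<in> X" if "set ds \<subseteq> Basis" for ds
    using that by (induction ds) (auto intro: assms)
  then show ?thesis
    unfolding Cinf_def using assms(2) by blast
qed

lemma Cinf_imp_differentiable: "Cinf f \<Longrightarrow> f differentiable (at x)"
  by (auto simp: Cinf_def dest: spec[of _ "[]"])

lemma Cinf_pdir:
  assumes "Cinf f" "b \<in> Basis"
  shows "Cinf (pdir b f)"
  unfolding Cinf_def
proof (intro allI impI)
  fix ds :: "'a list" and x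
  assume "set ds \<subseteq> Basis"
  then have "set (ds @ [b]) \<subseteq> Basis"
    using assms(2) by simp
  then have "foldr pdir (ds @ [b]) f differentiable (at x)"
    using assms(1) unfolding Cinf_def by blast
  then show "foldr pdir ds (pdir b f) differentiable (at x)"
    by simp
qed

lemma pdir_eqI:
  assumes "\<And>x. (f has_derivative D x) (at x)"
  shows "pdir v f = (\<lambda>x. D x v)"
  using frechet_derivative_at[OF assms] by (simp add: pdir_def fun_eq_iff)

lemma has_derivative_pdir:
  assumes "f differentiable (at x)"
  shows "(f has_derivative (\<lambda>v. pdir v f x)) (at x)"
  using assms by (simp add: pdir_def frechet_derivative_works)

lemma pdir_add:
  assumes "\<And>x. f differentiable (at x)" "\<And>x. g differentiable (at x)"
  shows "pdir v (\<lambda>x. f x + g x) = (\<lambda>x. pdir v f x + pdir v g x)"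
  by (rule pdir_eqI[OF has_derivative_add[OF assms[THEN has_derivative_pdir]]])

lemma pdir_mult:
  assumes "\<And>x. f differentiable (at x)" "\<And>x. g differentiable (at x)"
  shows "pdir v (\<lambda>x. f x * g x) = (\<lambda>x. f x * pdir v g x + pdir v f x * g x)"
  by (rule pdir_eqI[OF has_derivative_mult[OF assms[THEN has_derivative_pdir]]])

lemma pdir_compose:
  fixes \<phi> :: "real \<Rightarrow> real"
  assumes "\<And>t. \<phi> differentiable (at t)" "\<And>x. g differentiable (at x)"
  shows "pdir v (\<lambda>x. \<phi> (g x)) = (\<lambda>x. pdir 1 \<phi> (g x) * pdir v g x)"
proof (rule pdir_eqI)
  fix x
  have "((\<lambda>x. \<phi> (g x)) has_derivative (\<lambda>v. pdir (pdir v g x) \<phi> (g x))) (at x)"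
    by (rule has_derivative_compose[OF assms(2,1)[THEN has_derivative_pdir]])
  moreover have "pdir (pdir v g x) \<phi> (g x) = pdir 1 \<phi> (g x) * pdir v g x" for v
    using linear_scale[OF has_derivative_linear[OF has_derivative_pdir[OF assms(1)]], of "pdir v g x" 1]
    by (simp add: mult.commute)
  ultimately show "((\<lambda>x. \<phi> (g x)) has_derivative (\<lambda>v. pdir 1 \<phi> (g x) * pdir v g x)) (at x)"
    by simp
qed

text \<open>Leibniz's rule and the chain rule express the partial derivatives of products and
  compositions by sums of products, so the three closure properties need a joint coinduction.\<close>
inductive Cinf_closure :: "('a::euclidean_space \<Rightarrow> real) \<Rightarrow> bool" where
  base: "Cinf f \<Longrightarrow> Cinf_closure f"
| add: "Cinf_closure f \<Longrightarrow> Cinf_closure g \<Longrightarrow> Cinf_closure (\<lambda>x. f x + g x)"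
| mult: "Cinf_closure f \<Longrightarrow> Cinf_closure g \<Longrightarrow> Cinf_closure (\<lambda>x. f x * g x)"
| compose: "Cinf \<phi> \<Longrightarrow> Cinf_closure g \<Longrightarrow> Cinf_closure (\<lambda>x. \<phi> (g x))" for \<phi> :: "real \<Rightarrow> real"

lemma Cinf_closure_imp_differentiable: "Cinf_closure f \<Longrightarrow> f differentiable (at x)"
proof (induction rule: Cinf_closure.induct)
  case (compose \<phi> g)
  show ?case
    using differentiable_compose[OF Cinf_imp_differentiable[OF compose.hyps(1)] compose.IH] .
qed (simp_all add: Cinf_imp_differentiable)

lemma Cinf_closure_pdir:
  assumes "Cinf_closure f" "b \<in> Basis"
  shows "Cinf_closure (pdir b f)"
  using assms(1)
proof (induction rule: Cinf_closure.induct)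
  case (compose \<phi> g)
  have "Cinf_closure (\<lambda>x. pdir 1 \<phi> (g x))"
    using Cinf_closure.compose[OF Cinf_pdir[OF compose.hyps(1)] compose.hyps(2)] by simp
  with compose show ?case
    by (simp add: pdir_compose Cinf_imp_differentiable Cinf_closure_imp_differentiable Cinf_closure.mult)
qed (simp_all add: pdir_add pdir_mult Cinf_closure_imp_differentiable Cinf_pdir assms(2)
    Cinf_closure.base Cinf_closure.add Cinf_closure.mult)

lemma Cinf_closure_imp_Cinf: "Cinf_closure f \<Longrightarrow> Cinf f"
  by (rule Cinf_coinduct[of _ "Collect Cinf_closure"]) (simp_all add: Cinf_closure_imp_differentiable Cinf_closure_pdir)

lemma Cinf_add: "Cinf f \<Longrightarrow> Cinf g \<Longrightarrow> Cinf (\<lambda>x. f x + g x)"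
  by (simp add: Cinf_closure_imp_Cinf Cinf_closure.add Cinf_closure.base)

lemma Cinf_mult: "Cinf f \<Longrightarrow> Cinf g \<Longrightarrow> Cinf (\<lambda>x. f x * g x)"
  by (simp add: Cinf_closure_imp_Cinf Cinf_closure.mult Cinf_closure.base)

lemma Cinf_compose: "Cinf \<phi> \<Longrightarrow> Cinf g \<Longrightarrow> Cinf (\<lambda>x. \<phi> (g x))" for \<phi> :: "real \<Rightarrow> real"
  by (simp add: Cinf_closure_imp_Cinf Cinf_closure.compose Cinf_closure.base)

lemma pdir_const: "pdir v (\<lambda>x. c) = (\<lambda>x. 0)"
  by (rule pdir_eqI[OF has_derivative_const])

lemma Cinf_const: "Cinf (\<lambda>x. c)"
proof (rule Cinf_coinduct[of _ "range (\<lambda>c x. c)"])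
  show "pdir b g \<in> range (\<lambda>c x. c)" if "g \<in> range (\<lambda>c x. c)" for b and g :: "'a \<Rightarrow> real"
    using that by (auto simp: pdir_const)
qed auto

lemma CinfI:
  assumes "\<And>x. f differentiable (at x)" "\<And>b. b \<in> Basis \<Longrightarrow> Cinf (pdir b f)"
  shows "Cinf f"
  by (rule Cinf_coinduct[of _ "insert f (Collect Cinf)"])
    (use assms in \<open>auto intro: Cinf_imp_differentiable Cinf_pdir\<close>)

lemma Cinf_bounded_linear:
  assumes "bounded_linear f"
  shows "Cinf f"
proof (rule CinfI)
  note deriv = bounded_linear_imp_has_derivative[OF assms]
  show "f differentiable (at x)" for x
    using deriv by (rule differentiableI)
  show "Cinf (pdir b f)" for b
    by (simp add: pdir_eqI[OF deriv] Cinf_const)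
qed

lemma Cinf_real_polynomial_function: "real_polynomial_function f \<Longrightarrow> Cinf f"
  by (induction rule: real_polynomial_function.induct)
    (simp_all add: Cinf_bounded_linear Cinf_const Cinf_add Cinf_mult)

section \<open>Bump functions\<close>

definition flat_exp :: "real poly \<Rightarrow> real \<Rightarrow> real" where
  "flat_exp q t = (if 0 < t then poly q (inverse t) * exp (- inverse t) else 0)"

lemma tendsto_poly_div_exp_0: "((\<lambda>s. poly q s / exp s) \<longlongrightarrow> 0) at_top" for q :: "real poly"
proof -
  have "((\<lambda>s. \<Sum>i\<le>degree q. coeff q i * (s ^ i / exp s)) \<longlongrightarrow> (\<Sum>i\<le>degree q. coeff q i * 0)) at_top"
    by (intro tendsto_intros tendsto_power_div_exp_0)
  then show ?thesis
    by (simp add: poly_altdef sum_divide_distrib)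
qed

lemma tendsto_flat_exp_0: "(flat_exp q \<longlongrightarrow> 0) (at 0)"
proof (rule filterlim_split_at)
  have "((\<lambda>t. poly q (inverse t) / exp (inverse t)) \<longlongrightarrow> 0) (at_right 0)"
    by (rule filterlim_compose[OF tendsto_poly_div_exp_0 filterlim_inverse_at_top_right])
  moreover have "\<forall>\<^sub>F t in at_right 0. poly q (inverse t) / exp (inverse t) = flat_exp q t"
    by (auto simp: flat_exp_def eventually_at_filter exp_minus divide_inverse)
  ultimately show "(flat_exp q \<longlongrightarrow> 0) (at_right 0)"
    by (rule Lim_transform_eventually)
  show "(flat_exp q \<longlongrightarrow> 0) (at_left 0)"
    by (rule tendsto_eventually) (auto simp: flat_exp_def eventually_at_filter)
qed

lemma has_real_derivative_flat_exp:
  "(flat_exp q has_real_derivative flat_exp ([:0, 0, 1:] * (q - pderiv q)) t) (at t)"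
proof -
  consider "0 < t" | "t < 0" | "t = 0" by linarith
  then show ?thesis
  proof cases
    assume "0 < t"
    then have "((\<lambda>t. poly q (inverse t) * exp (- inverse t)) has_real_derivative
        flat_exp ([:0, 0, 1:] * (q - pderiv q)) t) (at t)"
      by (auto intro!: derivative_eq_intros simp: flat_exp_def power2_eq_square algebra_simps)
    then show ?thesis
      by (rule has_field_derivative_transform_within_open[where S = "{0<..}"])
        (use \<open>0 < t\<close> in \<open>auto simp: flat_exp_def\<close>)
  next
    assume "t < 0"
    then have "((\<lambda>t. 0) has_real_derivative flat_exp ([:0, 0, 1:] * (q - pderiv q)) t) (at t)"
      by (simp add: flat_exp_def)
    then show ?thesis
      by (rule has_field_derivative_transform_within_open[where S = "{..<0}"])
        (use \<open>t < 0\<close> in \<open>auto simp: flat_exp_def\<close>)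
  next
    assume "t = 0"
    have "\<forall>\<^sub>F s in at 0. flat_exp (pCons 0 q) s = (flat_exp q s - flat_exp q 0) / (s - 0)"
      by (auto simp: flat_exp_def eventually_at_filter divide_inverse)
    with tendsto_flat_exp_0 have "((\<lambda>s. (flat_exp q s - flat_exp q 0) / (s - 0)) \<longlongrightarrow> 0) (at 0)"
      by (rule Lim_transform_eventually)
    then show ?thesis
      unfolding \<open>t = 0\<close> by (simp add: has_field_derivative_iff flat_exp_def)
  qed
qed

lemma Cinf_flat_exp: "Cinf (flat_exp q)"
proof -
  have deriv: "(flat_exp q has_derivative (*) (flat_exp ([:0, 0, 1:] * (q - pderiv q)) t)) (at t)" for q t
    by (rule has_field_derivative_imp_has_derivative[OF has_real_derivative_flat_exp])
  have "flat_exp q \<in> range flat_exp"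
    by simp
  then show ?thesis
  proof (coinduct rule: Cinf_coinduct)
    case (differentiable g t)
    then show ?case
      using deriv by (auto simp: differentiable_def)
  next
    case (pdir g b)
    then obtain q where "g = flat_exp q"
      by blast
    with pdir have "pdir b g = flat_exp ([:0, 0, 1:] * (q - pderiv q))"
      by (simp add: pdir_eqI[OF deriv])
    then show ?case
      by blast
  qed
qed

definition bump :: "'a::euclidean_space \<Rightarrow> real \<Rightarrow> 'a \<Rightarrow> real" where
  "bump a R x = flat_exp 1 (R\<^sup>2 - (dist a x)\<^sup>2)"

lemma bump_nonneg: "0 \<le> bump a R x"
  by (simp add: bump_def flat_exp_def)

lemma bump_le_1: "bump a R x \<le> 1"
  by (simp add: bump_def flat_exp_def)

lemma bump_eq_0_iff:
  assumes "0 \<le> R"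
  shows "bump a R x = 0 \<longleftrightarrow> x \<notin> ball a R"
proof -
  have "(dist a x)\<^sup>2 < R\<^sup>2 \<longleftrightarrow> dist a x < R"
    using assms power2_le_iff_abs_le[of R "dist a x"] by (simp add: not_le[symmetric])
  then show ?thesis
    by (simp add: bump_def flat_exp_def)
qed

lemma abs_bump_mult_le:
  assumes "0 \<le> R" "x \<in> ball a R \<Longrightarrow> \<bar>c\<bar> \<le> C"
  shows "\<bar>bump a R x * c\<bar> \<le> \<bar>C * indicator (ball a R) x\<bar>"
proof (cases "x \<in> ball a R")
  case True
  have "bump a R x * \<bar>c\<bar> \<le> 1 * C"
    by (intro mult_mono bump_le_1 assms(2) True) auto
  with True show ?thesis
    by (simp add: abs_mult bump_nonneg)
qed (simp add: assms(1) bump_eq_0_iff[THEN iffD2])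

lemma tendsto_bump_mult:
  assumes "0 \<le> R" "x \<in> ball a R \<Longrightarrow> (f \<longlongrightarrow> l) F"
  shows "((\<lambda>i. bump a R x * f i) \<longlongrightarrow> bump a R x * l) F"
proof (cases "x \<in> ball a R")
  case True
  then show ?thesis
    by (intro tendsto_mult_left assms(2))
qed (simp add: assms(1) bump_eq_0_iff[THEN iffD2])

lemma Cinf_bump: "Cinf (bump a R)"
proof -
  have "(dist a x)\<^sup>2 = (\<Sum>b\<in>Basis. (x \<bullet> b - a \<bullet> b)\<^sup>2)" for x
    by (subst euclidean_dist_l2) (simp add: L2_set_def sum_nonneg dist_real_def power2_commute)
  moreover have "real_polynomial_function (\<lambda>x. (x \<bullet> b - a \<bullet> b)\<^sup>2)" for b
    by (intro real_polynomial_function_power real_polynomial_function_diff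
        real_polynomial_function.intros(1)[OF bounded_linear_inner_left] real_polynomial_function.intros(2))
  then have "real_polynomial_function (\<lambda>x. R\<^sup>2 - (\<Sum>b\<in>Basis. (x \<bullet> b - a \<bullet> b)\<^sup>2))"
    by (simp add: real_polynomial_function_diff real_polynomial_function_sum real_polynomial_function.intros(2))
  ultimately have "Cinf (\<lambda>x. R\<^sup>2 - (dist a x)\<^sup>2)"
    by (simp add: Cinf_real_polynomial_function)
  then have "Cinf (\<lambda>x. flat_exp 1 (R\<^sup>2 - (dist a x)\<^sup>2))"
    by (rule Cinf_compose[OF Cinf_flat_exp])
  then show ?thesis
    by (simp add: bump_def[abs_def])
qed

lemma bump_mult_in_C0_inf:
  assumes "Cinf g" "0 \<le> R"
  shows "(\<lambda>x. bump a R x * g x) \<in> C0_inf"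
proof -
  have "{x. bump a R x * g x \<noteq> 0} \<subseteq> ball a R"
    using assms(2) by (auto simp: bump_eq_0_iff)
  then have "compact (closure {x. bump a R x * g x \<noteq> 0})"
    using bounded_subset[OF bounded_ball] by simp
  then show ?thesis
    by (simp add: C0_inf_def Cinf_mult[OF Cinf_bump assms(1)])
qed

lemma Cinf_measurable:
  assumes "Cinf g"
  shows "g \<in> borel_measurable lebesgue"
proof -
  have "continuous_on UNIV g"
    using assms
    by (simp add: continuous_at_imp_continuous_on differentiable_imp_continuous_within Cinf_imp_differentiable)
  then show ?thesis
    by (simp add: borel_measurable_continuous_onI measurable_completion)
qed

lemma C0_inf_measurable: "C0_inf \<subseteq> borel_measurable lebesgue"
  by (auto simp: C0_inf_def Cinf_measurable)

lemmas bump_measurable [measurable] = Cinf_measurable[OF Cinf_bump]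

section \<open>Bounded measurable functions as limits of polynomials\<close>

definition truncate_at :: "real \<Rightarrow> real \<Rightarrow> real" where
  "truncate_at c t = max (- c) (min c t)"

lemma abs_truncate_at_le: "0 \<le> c \<Longrightarrow> \<bar>truncate_at c t\<bar> \<le> c"
  by (auto simp: truncate_at_def)

lemma truncate_at_eq: "\<bar>t\<bar> \<le> c \<Longrightarrow> truncate_at c t = t"
  by (auto simp: truncate_at_def)

lemma abs_diff_truncate_at_le: "0 \<le> c \<Longrightarrow> \<bar>t - truncate_at c t\<bar> \<le> \<bar>t\<bar>"
  by (auto simp: truncate_at_def)

lemma continuous_on_truncate_at: "continuous_on S f \<Longrightarrow> continuous_on S (\<lambda>x. truncate_at c (f x))"
  unfolding truncate_at_def by (intro continuous_intros)

lemma tendsto_truncate_at: "(f \<longlongrightarrow> l) F \<Longrightarrow> ((\<lambda>x. truncate_at c (f x)) \<longlongrightarrow> truncate_at c l) F"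
  unfolding truncate_at_def by (intro tendsto_intros)

lemma truncate_at_tendsto_id: "(\<lambda>n. truncate_at (real n) t) \<longlonglongrightarrow> t"
proof (rule tendsto_eventually)
  have "\<forall>\<^sub>F n in sequentially. \<bar>t\<bar> \<le> real n"
    using filterlim_real_sequentially by (auto simp: filterlim_at_top)
  then show "\<forall>\<^sub>F n in sequentially. truncate_at (real n) t = t"
    by eventually_elim (rule truncate_at_eq)
qed

lemma bounded_measurable_AE_limit_continuous:
  fixes k :: "'a::euclidean_space \<Rightarrow> real"
  assumes "k \<in> borel_measurable lebesgue" "\<And>x. \<bar>k x\<bar> \<le> M"
  obtains g :: "nat \<Rightarrow> 'a \<Rightarrow> real" where "\<And>n. continuous_on UNIV (g n)"
    "\<And>n x. \<bar>g n x\<bar> \<le> M" "AE x in lebesgue. (\<lambda>n. g n x) \<longlonglongrightarrow> k x"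
proof -
  have "k measurable_on UNIV"
    by (intro lebesgue_measurable_imp_measurable_on assms(1)) simp
  then obtain Z g where Z: "negligible Z" and g: "\<And>n. continuous_on UNIV (g n)"
    and g_lim: "\<And>x. x \<notin> Z \<Longrightarrow> (\<lambda>n. g n x) \<longlonglongrightarrow> k x"
    unfolding measurable_on_def by auto
  show ?thesis
  proof (rule that[of "\<lambda>n x. truncate_at M (g n x)"])
    show "continuous_on UNIV (\<lambda>x. truncate_at M (g n x))" for n
      by (intro continuous_on_truncate_at g)
    show "\<bar>truncate_at M (g n x)\<bar> \<le> M" for n x
      using assms(2)[of x] by (intro abs_truncate_at_le) simp
    have "(\<lambda>n. truncate_at M (g n x)) \<longlonglongrightarrow> k x" if "x \<notin> Z" for x
      using tendsto_truncate_at[OF g_lim[OF that], of M] by (simp add: truncate_at_eq assms(2))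
    moreover have "AE x in lebesgue. x \<notin> Z"
      using Z by (intro AE_not_in) (simp add: negligible_iff_null_sets)
    ultimately show "AE x in lebesgue. (\<lambda>n. truncate_at M (g n x)) \<longlonglongrightarrow> k x"
      by (auto elim!: eventually_mono)
  qed
qed

lemma bounded_measurable_AE_limit_polynomials:
  fixes k :: "'a::euclidean_space \<Rightarrow> real"
  assumes k: "k \<in> borel_measurable lebesgue" "\<And>x. \<bar>k x\<bar> \<le> M" and S: "compact S"
  obtains P :: "nat \<Rightarrow> 'a \<Rightarrow> real" where "\<And>n. real_polynomial_function (P n)"
    "\<And>n x. x \<in> S \<Longrightarrow> \<bar>P n x\<bar> \<le> M + 1" "AE x in lebesgue. x \<in> S \<longrightarrow> (\<lambda>n. P n x) \<longlonglongrightarrow> k x"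
proof -
  obtain g :: "nat \<Rightarrow> 'a \<Rightarrow> real" where g: "\<And>n. continuous_on UNIV (g n)"
    and g_le: "\<And>n x. \<bar>g n x\<bar> \<le> M" and g_lim: "AE x in lebesgue. (\<lambda>n. g n x) \<longlonglongrightarrow> k x"
    using bounded_measurable_AE_limit_continuous[OF k] by blast
  have "\<exists>P. real_polynomial_function P \<and> (\<forall>x\<in>S. \<bar>g n x - P x\<bar> < inverse (Suc n))" for n
    using Stone_Weierstrass_real_polynomial_function[OF S continuous_on_subset[OF g subset_UNIV]]
    by (metis inverse_positive_iff_positive of_nat_0_less_iff zero_less_Suc)
  then obtain P where P: "\<And>n. real_polynomial_function (P n)"
    and P_close: "\<And>n x. x \<in> S \<Longrightarrow> \<bar>g n x - P n x\<bar> < inverse (Suc n)"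
    by metis
  show ?thesis
  proof (rule that[OF P])
    show "\<bar>P n x\<bar> \<le> M + 1" if "x \<in> S" for n x
    proof -
      have "inverse (real (Suc n)) \<le> 1"
        by (simp add: field_simps)
      then show ?thesis
        using P_close[OF that, of n] g_le[of n x] by linarith
    qed
    show "AE x in lebesgue. x \<in> S \<longrightarrow> (\<lambda>n. P n x) \<longlonglongrightarrow> k x"
      using g_lim
    proof (eventually_elim, intro impI)
      fix x
      assume lim: "(\<lambda>n. g n x) \<longlonglongrightarrow> k x" and "x \<in> S"
      then have "(\<lambda>n. g n x - P n x) \<longlonglongrightarrow> 0"
        using P_close
        by (intro tendsto_rabs_zero_cancel[OF tendsto_sandwich[OF _ _ tendsto_const LIMSEQ_inverse_real_of_nat]])
          (auto intro!: always_eventually less_imp_le)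
      then show "(\<lambda>n. P n x) \<longlonglongrightarrow> k x"
        using tendsto_diff[OF lim] by fastforce
    qed
  qed
qed

section \<open>Morrey functionals\<close>

text \<open>The functions are only Lebesgue measurable, so additivity of the integral needs the
  completed measure.\<close>
lemma morrey_M_lebesgue:
  "morrey_M p lam f x r =
    ennreal (r powr (- lam)) * (\<integral>\<^sup>+ y \<in> ball x r. ennreal (\<bar>f y\<bar> powr p) \<partial>lebesgue)"
  by (simp add: morrey_M_def nn_integral_completion)

lemma morrey_M_le_morrey_sup: "0 < r \<Longrightarrow> morrey_M p lam f x r \<le> morrey_sup p lam f"
  unfolding morrey_sup_def by (rule SUP_upper2[of "(x, r)"]) auto

lemma morrey_sup_leI:
  "(\<And>x r. 0 < r \<Longrightarrow> morrey_M p lam f x r \<le> e) \<Longrightarrow> morrey_sup p lam f \<le> e"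
  unfolding morrey_sup_def by (rule SUP_least) auto

lemma morrey_sup_zero: "morrey_sup p lam (\<lambda>x. 0) = 0"
  by (rule antisym[OF morrey_sup_leI]) (simp_all add: morrey_M_def)

lemma morrey_M_mono:
  assumes "0 \<le> p" "\<And>y. \<bar>f y\<bar> \<le> \<bar>g y\<bar>"
  shows "morrey_M p lam f x r \<le> morrey_M p lam g x r"
  unfolding morrey_M_def
  by (intro mult_left_mono nn_integral_mono mult_right_mono ennreal_leI powr_mono2)
    (use assms in auto)

lemma morrey_M_le_nn_integral:
  assumes "0 \<le> lam" "0 < d" "d \<le> r"
  shows "morrey_M p lam f x r
    \<le> ennreal (d powr (- lam)) * (\<integral>\<^sup>+ y \<in> ball x r. ennreal (\<bar>f y\<bar> powr p) \<partial>lebesgue)"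
  unfolding morrey_M_lebesgue
  using assms by (intro mult_right_mono ennreal_leI powr_mono2') auto

lemma borel_measurable_abs_powr_ennreal [measurable]:
  fixes f :: "'a \<Rightarrow> real"
  assumes [measurable]: "f \<in> borel_measurable M"
  shows "(\<lambda>y. ennreal (\<bar>f y\<bar> powr p)) \<in> borel_measurable M"
  by measurable

lemma sets_lebesgue_ball [measurable]: "ball a r \<in> sets lebesgue"
  by simp

lemma abs_add_powr_le:
  fixes a b :: real
  assumes "0 \<le> p"
  shows "\<bar>a + b\<bar> powr p \<le> 2 powr p * (\<bar>a\<bar> powr p + \<bar>b\<bar> powr p)"
proof -
  have "\<bar>a + b\<bar> powr p \<le> (2 * max \<bar>a\<bar> \<bar>b\<bar>) powr p"
    using assms by (intro powr_mono2) auto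
  also have "\<dots> = 2 powr p * max \<bar>a\<bar> \<bar>b\<bar> powr p"
    by (simp add: powr_mult)
  also have "max \<bar>a\<bar> \<bar>b\<bar> powr p \<le> \<bar>a\<bar> powr p + \<bar>b\<bar> powr p"
    by (auto simp: max_def)
  finally show ?thesis by simp
qed

text \<open>For closures the constant is harmless, so Minkowski's inequality is not needed.\<close>
lemma morrey_sup_quasi_triangle:
  assumes p: "0 \<le> p"
    and [measurable]: "f \<in> borel_measurable lebesgue" "g \<in> borel_measurable lebesgue" "h \<in> borel_measurable lebesgue"
  shows "morrey_sup p lam (f - h) \<le> ennreal (2 powr p) * (morrey_sup p lam (f - g) + morrey_sup p lam (g - h))"
proof (rule morrey_sup_leI)
  fix x :: 'a and r :: real
  assume r: "0 < r"
  have "ennreal (\<bar>f y - h y\<bar> powr p) \<le>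
      ennreal (2 powr p) * (ennreal (\<bar>f y - g y\<bar> powr p) + ennreal (\<bar>g y - h y\<bar> powr p))" for y
    using abs_add_powr_le[OF p, of "f y - g y" "g y - h y"]
    by (simp add: ennreal_mult[symmetric] ennreal_plus[symmetric] ennreal_leI del: ennreal_plus)
  then have "(\<integral>\<^sup>+ y \<in> ball x r. ennreal (\<bar>f y - h y\<bar> powr p) \<partial>lebesgue) \<le>
      (\<integral>\<^sup>+ y. ennreal (2 powr p) * (ennreal (\<bar>f y - g y\<bar> powr p) * indicator (ball x r) y
        + ennreal (\<bar>g y - h y\<bar> powr p) * indicator (ball x r) y) \<partial>lebesgue)"
    by (intro nn_integral_mono) (simp add: indicator_def)
  also have "\<dots> = ennreal (2 powr p) * ((\<integral>\<^sup>+ y \<in> ball x r. ennreal (\<bar>f y - g y\<bar> powr p) \<partial>lebesgue)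
      + (\<integral>\<^sup>+ y \<in> ball x r. ennreal (\<bar>g y - h y\<bar> powr p) \<partial>lebesgue))"
    by (simp add: nn_integral_cmult nn_integral_add)
  finally have "morrey_M p lam (f - h) x r \<le> ennreal (r powr - lam) *
      (ennreal (2 powr p) * ((\<integral>\<^sup>+ y \<in> ball x r. ennreal (\<bar>f y - g y\<bar> powr p) \<partial>lebesgue)
      + (\<integral>\<^sup>+ y \<in> ball x r. ennreal (\<bar>g y - h y\<bar> powr p) \<partial>lebesgue)))"
    unfolding morrey_M_lebesgue by (simp add: mult_left_mono)
  also have "\<dots> = ennreal (2 powr p) * (morrey_M p lam (f - g) x r + morrey_M p lam (g - h) x r)"
    by (simp add: morrey_M_lebesgue algebra_simps)
  also have "\<dots> \<le> ennreal (2 powr p) * (morrey_sup p lam (f - g) + morrey_sup p lam (g - h))"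
    by (intro mult_left_mono add_mono morrey_M_le_morrey_sup r) simp
  finally show "morrey_M p lam (f - h) x r \<le> \<dots>" .
qed

lemma ennreal_tendsto_zero_iff:
  fixes f :: "'a \<Rightarrow> ennreal"
  shows "(f \<longlongrightarrow> 0) F \<longleftrightarrow> (\<forall>e>0. \<forall>\<^sub>F x in F. f x \<le> e)"
proof
  show "(f \<longlongrightarrow> 0) F" if "\<forall>e>0. \<forall>\<^sub>F x in F. f x \<le> e"
  proof (rule order_tendstoI)
    fix e :: ennreal
    assume "0 < e"
    then obtain d where "0 < d" "d < e"
      using dense by blast
    then show "\<forall>\<^sub>F x in F. f x < e"
      using that by (auto elim!: eventually_mono)
  qed simp
qed (auto dest!: order_tendstoD(2) elim!: eventually_mono)

lemma morrey_spaceI: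
  assumes "f \<in> borel_measurable lebesgue" "morrey_sup p lam f < \<infinity>"
  shows "f \<in> morrey_space p lam"
proof -
  have "(\<integral>\<^sup>+ y \<in> K. ennreal (\<bar>f y\<bar> powr p) \<partial>lborel) < \<infinity>" if K: "compact K" for K
  proof -
    obtain r where r: "0 < r" "K \<subseteq> ball 0 r"
      using bounded_subset_ballD[OF compact_imp_bounded[OF K], of 0] by auto
    have "(\<integral>\<^sup>+ y \<in> K. ennreal (\<bar>f y\<bar> powr p) \<partial>lborel) \<le> (\<integral>\<^sup>+ y \<in> ball 0 r. ennreal (\<bar>f y\<bar> powr p) \<partial>lborel)"
      using r by (intro nn_integral_mono) (auto simp: indicator_def)
    also have "\<dots> < \<infinity>"
      using morrey_M_le_morrey_sup[OF r(1), of p lam f 0] assms(2) r(1)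
      by (auto simp: morrey_M_def ennreal_mult_less_top less_top[symmetric] ennreal_mult_eq_top_iff top_unique)
    finally show ?thesis .
  qed
  with assms show ?thesis by (auto simp: morrey_space_def Lp_loc_def)
qed

lemma morrey_norm_less:
  assumes "0 < p" "0 < \<epsilon>" "morrey_sup p lam f < ennreal (\<epsilon> powr p)"
  shows "morrey_norm p lam f < \<epsilon>"
proof -
  have "enn2real (morrey_sup p lam f) < \<epsilon> powr p"
    using assms by (cases "morrey_sup p lam f") (auto simp: ennreal_less_iff)
  then have "morrey_norm p lam f < (\<epsilon> powr p) powr (1 / p)"
    unfolding morrey_norm_def using assms(1) by (intro powr_less_mono2) auto
  also have "\<dots> = \<epsilon>"
    using assms(1,2) by (simp add: powr_powr)
  finally show ?thesis .
qed

section \<open>Vanishing Morrey functionals\<close>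

definition morrey_vanishing :: "real \<Rightarrow> real \<Rightarrow> real filter \<Rightarrow> ('a::euclidean_space \<Rightarrow> real) \<Rightarrow> bool" where
  "morrey_vanishing p lam F f \<longleftrightarrow> ((\<lambda>r. SUP x. morrey_M p lam f x r) \<longlongrightarrow> 0) F"

lemma morrey_vanishing_iff:
  "morrey_vanishing p lam F f \<longleftrightarrow> (\<forall>e>0. \<forall>\<^sub>F r in F. \<forall>x. morrey_M p lam f x r \<le> e)"
  by (simp add: morrey_vanishing_def ennreal_tendsto_zero_iff SUP_le_iff)

lemma morrey_vanishing_mono:
  assumes "morrey_vanishing p lam F g" "0 \<le> p" "\<And>y. \<bar>f y\<bar> \<le> \<bar>g y\<bar>"
  shows "morrey_vanishing p lam F f"
  using assms(1) morrey_M_mono[OF assms(2,3)] unfolding morrey_vanishing_iff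
  by (fast elim!: eventually_mono intro: order.trans)

lemma morrey_vanishing_const:
  fixes c :: real
  assumes "lam < real DIM('a)"
  shows "morrey_vanishing p lam (at_right 0) (\<lambda>_::'a::euclidean_space. c)"
proof -
  define C where "C = \<bar>c\<bar> powr p * unit_ball_vol (real DIM('a))"
  have "0 \<le> C"
    by (simp add: C_def)
  then have morrey_M_const: "morrey_M p lam (\<lambda>_. c) x r = ennreal (C * r powr (real DIM('a) - lam))" if "0 < r" for x :: 'a and r
    using that
    by (simp add: C_def morrey_M_def emeasure_ball nn_integral_cmult_indicator ennreal_mult[symmetric]
        powr_diff powr_minus powr_realpow field_simps)
  have "((\<lambda>r. C * r powr (real DIM('a) - lam)) \<longlongrightarrow> C * 0 powr (real DIM('a) - lam)) (at_right 0)"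
    using assms by (intro tendsto_intros) (auto simp: eventually_at_filter)
  then have "((\<lambda>r. ennreal (C * r powr (real DIM('a) - lam))) \<longlongrightarrow> 0) (at_right 0)"
    using tendsto_ennrealI by fastforce
  then show ?thesis
    unfolding morrey_vanishing_def
    by (rule Lim_transform_eventually) (auto simp: eventually_at_filter morrey_M_const)
qed

lemma morrey_sup_tendsto_0I:
  assumes p: "0 \<le> p" and w: "morrey_vanishing p lam (at_right 0) w" and u_le: "\<And>k y. \<bar>u k y\<bar> \<le> \<bar>w y\<bar>"
    and large_radii: "\<And>d e. 0 < d \<Longrightarrow> 0 < e \<Longrightarrow> \<forall>\<^sub>F k in F. \<forall>x. \<forall>r\<ge>d. morrey_M p lam (u k) x r \<le> e"
  shows "((\<lambda>k. morrey_sup p lam (u k)) \<longlongrightarrow> 0) F"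
  unfolding ennreal_tendsto_zero_iff
proof (intro allI impI)
  fix e :: ennreal
  assume e: "0 < e"
  then have "\<forall>\<^sub>F r in at_right 0. \<forall>x. morrey_M p lam w x r \<le> e"
    using w by (simp add: morrey_vanishing_iff)
  then obtain d where d: "0 < d" "\<And>x r. 0 < r \<Longrightarrow> r < d \<Longrightarrow> morrey_M p lam w x r \<le> e"
    by (auto simp: eventually_at_right_field)
  show "\<forall>\<^sub>F k in F. morrey_sup p lam (u k) \<le> e"
    using large_radii[OF d(1) e]
  proof eventually_elim
    case (elim k)
    show ?case
    proof (rule morrey_sup_leI)
      fix x and r :: real
      assume "0 < r"
      show "morrey_M p lam (u k) x r \<le> e"
      proof (cases "r < d")
        case True
        show ?thesis
          by (rule order.trans[OF morrey_M_mono[OF p u_le] d(2)[OF \<open>0 < r\<close> True]])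
      qed (use elim in simp)
    qed
  qed
qed

lemma nn_integral_ball_le_SUP_balls:
  fixes R s :: real
  assumes "0 < s"
  obtains K :: nat where "\<And>g x r. g \<in> borel_measurable lebesgue \<Longrightarrow> r \<le> R \<Longrightarrow>
    (\<integral>\<^sup>+ y \<in> ball x r. g y \<partial>lebesgue) \<le> of_nat K * (SUP z::'a::euclidean_space. \<integral>\<^sup>+ y \<in> ball z s. g y \<partial>lebesgue)"
proof -
  have "cball (0::'a) R \<subseteq> (\<Union>c. ball c s)"
    using assms centre_in_ball by blast
  then obtain F where F: "finite F" "cball (0::'a) R \<subseteq> (\<Union>c\<in>F. ball c s)"
    using compactE_image[OF compact_cball, of UNIV "\<lambda>c. ball c s"] by (metis open_ball)
  show ?thesis
  proof (rule that[of "card F"])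
    fix g :: "'a \<Rightarrow> ennreal" and x :: 'a and r :: real
    assume [measurable]: "g \<in> borel_measurable lebesgue" and r: "r \<le> R"
    have "g y * indicator (ball x r) y \<le> (\<Sum>c\<in>F. g y * indicator (ball (x + c) s) y)" for y
    proof (cases "y \<in> ball x r")
      case True
      then have "y - x \<in> cball 0 R"
        using r by (auto simp: dist_norm norm_minus_commute)
      then obtain c where c: "c \<in> F" "y - x \<in> ball c s"
        using F by blast
      then have "y \<in> ball (x + c) s"
        by (simp add: dist_norm algebra_simps)
      then show ?thesis
        using True member_le_sum[OF c(1) _ F(1), of "\<lambda>c. g y * indicator (ball (x + c) s) y"] by auto
    qed simp
    then have "(\<integral>\<^sup>+ y \<in> ball x r. g y \<partial>lebesgue) \<le> (\<integral>\<^sup>+ y. (\<Sum>c\<in>F. g y * indicator (ball (x + c) s) y) \<partial>lebesgue)"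
      by (rule nn_integral_mono)
    also have "\<dots> = (\<Sum>c\<in>F. \<integral>\<^sup>+ y \<in> ball (x + c) s. g y \<partial>lebesgue)"
      by (rule nn_integral_sum) measurable
    also have "\<dots> \<le> (\<Sum>c\<in>F. SUP z. \<integral>\<^sup>+ y \<in> ball z s. g y \<partial>lebesgue)"
      by (intro sum_mono SUP_upper) simp
    finally show "(\<integral>\<^sup>+ y \<in> ball x r. g y \<partial>lebesgue) \<le> of_nat (card F) * (SUP z. \<integral>\<^sup>+ y \<in> ball z s. g y \<partial>lebesgue)"
      by simp
  qed
qed

lemma morrey_M_le_SUP_balls:
  fixes R s :: real
  assumes lam: "0 \<le> lam" and d: "0 < d" and s: "0 < s"
  shows "\<exists>C<top. \<forall>u \<in> borel_measurable lebesgue. \<forall>x. \<forall>r \<in> {d..R}.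
    morrey_M p lam u x r \<le> C * (SUP z::'a::euclidean_space. \<integral>\<^sup>+ y \<in> ball z s. ennreal (\<bar>u y\<bar> powr p) \<partial>lebesgue)"
proof -
  obtain K :: nat where K: "\<And>g x r. g \<in> borel_measurable lebesgue \<Longrightarrow> r \<le> R \<Longrightarrow>
      (\<integral>\<^sup>+ y \<in> ball x r. g y \<partial>lebesgue) \<le> of_nat K * (SUP z::'a. \<integral>\<^sup>+ y \<in> ball z s. g y \<partial>lebesgue)"
    using nn_integral_ball_le_SUP_balls[OF s] by blast
  have "ennreal (d powr (- lam)) * of_nat K < top"
    by (simp add: ennreal_mult_less_top of_nat_less_top)
  moreover have "morrey_M p lam u x r \<le> ennreal (d powr (- lam)) * of_nat K *
      (SUP z. \<integral>\<^sup>+ y \<in> ball z s. ennreal (\<bar>u y\<bar> powr p) \<partial>lebesgue)"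
    if "u \<in> borel_measurable lebesgue" and r: "d \<le> r" "r \<le> R" for u :: "'a \<Rightarrow> real" and x r
    unfolding mult.assoc using that
    by (intro order.trans[OF morrey_M_le_nn_integral[OF lam d r(1)]] mult_left_mono K
        borel_measurable_abs_powr_ennreal) auto
  ultimately show ?thesis
    by (intro exI conjI ballI allI) auto
qed

lemma morrey_sup_tendsto_0_uniformly_local:
  fixes u :: "'i \<Rightarrow> 'a::euclidean_space \<Rightarrow> real"
  assumes lam: "0 \<le> lam" and p: "0 \<le> p" and s: "0 < s"
    and w: "morrey_vanishing p lam (at_right 0) w" "morrey_vanishing p lam at_top w"
    and u: "\<And>k. u k \<in> borel_measurable lebesgue" "\<And>k y. \<bar>u k y\<bar> \<le> \<bar>w y\<bar>"
    and local: "((\<lambda>k. SUP x. \<integral>\<^sup>+ y \<in> ball x s. ennreal (\<bar>u k y\<bar> powr p) \<partial>lebesgue) \<longlongrightarrow> 0) F"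
  shows "((\<lambda>k. morrey_sup p lam (u k)) \<longlongrightarrow> 0) F"
proof (rule morrey_sup_tendsto_0I[OF p w(1) u(2)])
  fix d :: real and e :: ennreal
  assume d: "0 < d" and e: "0 < e"
  obtain R where R: "\<And>x r. R \<le> r \<Longrightarrow> morrey_M p lam w x r \<le> e"
    using w(2) e unfolding morrey_vanishing_iff eventually_at_top_linorder by blast
  let ?S = "\<lambda>k. SUP x. \<integral>\<^sup>+ y \<in> ball x s. ennreal (\<bar>u k y\<bar> powr p) \<partial>lebesgue"
  obtain C where C: "C < top" and morrey_M_le: "\<forall>u \<in> borel_measurable lebesgue. \<forall>x. \<forall>r \<in> {d..R}.
      morrey_M p lam u x r \<le> C * (SUP z::'a. \<integral>\<^sup>+ y \<in> ball z s. ennreal (\<bar>u y\<bar> powr p) \<partial>lebesgue)"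
    using morrey_M_le_SUP_balls[OF lam d s, of R p] by blast
  have "((\<lambda>k. C * ?S k) \<longlongrightarrow> C * 0) F"
    by (rule ennreal_tendsto_cmult[OF C local])
  then have "\<forall>\<^sub>F k in F. C * ?S k \<le> e"
    using e by (simp add: ennreal_tendsto_zero_iff)
  then show "\<forall>\<^sub>F k in F. \<forall>x. \<forall>r\<ge>d. morrey_M p lam (u k) x r \<le> e"
  proof eventually_elim
    case (elim k)
    have "morrey_M p lam (u k) x r \<le> e" if "d \<le> r" for x r
    proof (cases "R \<le> r")
      case True
      show ?thesis
        by (rule order.trans[OF morrey_M_mono[OF p u(2)] R[OF True]])
    next
      case False
      show ?thesis
        by (rule order.trans[OF morrey_M_le[rule_format, OF u(1)] elim]) (use that False in simp)
    qed
    then show ?case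
      by blast
  qed
qed

lemma morrey_sup_dominated_convergence:
  fixes u :: "nat \<Rightarrow> 'a::euclidean_space \<Rightarrow> real"
  assumes lam: "0 \<le> lam" and p: "0 < p"
    and [measurable]: "\<And>k. u k \<in> borel_measurable lebesgue" "w \<in> borel_measurable lebesgue"
    and w: "morrey_vanishing p lam (at_right 0) w" "(\<integral>\<^sup>+ y. ennreal (\<bar>w y\<bar> powr p) \<partial>lebesgue) < \<infinity>"
    and u_le: "\<And>k y. \<bar>u k y\<bar> \<le> \<bar>w y\<bar>"
    and lim: "AE y in lebesgue. (\<lambda>k. u k y) \<longlonglongrightarrow> 0"
  shows "(\<lambda>k. morrey_sup p lam (u k)) \<longlonglongrightarrow> 0"
proof (rule morrey_sup_tendsto_0I[OF less_imp_le[OF p] w(1) u_le])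
  fix d :: real and e :: ennreal
  assume d: "0 < d" and e: "0 < e"
  let ?I = "\<lambda>k. \<integral>\<^sup>+ y. ennreal (\<bar>u k y\<bar> powr p) \<partial>lebesgue"
  have "?I \<longlonglongrightarrow> (\<integral>\<^sup>+ (y::'a). 0 \<partial>lebesgue)"
  proof (rule nn_integral_dominated_convergence[where w = "\<lambda>y. ennreal (\<bar>w y\<bar> powr p)"])
    show "AE y in lebesgue. ennreal (\<bar>u k y\<bar> powr p) \<le> ennreal (\<bar>w y\<bar> powr p)" for k
      by (intro AE_I2 ennreal_leI powr_mono2) (use u_le p in auto)
    show "AE y in lebesgue. (\<lambda>k. ennreal (\<bar>u k y\<bar> powr p)) \<longlonglongrightarrow> 0"
      using lim
    proof eventually_elim
      case (elim y)
      then have "(\<lambda>k. ennreal (\<bar>u k y\<bar> powr p)) \<longlonglongrightarrow> ennreal (\<bar>0\<bar> powr p)"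
        using p by (intro tendsto_ennrealI tendsto_powr' tendsto_rabs tendsto_const) auto
      then show ?case by simp
    qed
  qed (use w(2) in measurable)
  then have "(\<lambda>k. ennreal (d powr (- lam)) * ?I k) \<longlonglongrightarrow> ennreal (d powr (- lam)) * 0"
    by (intro ennreal_tendsto_cmult) simp_all
  then have "\<forall>\<^sub>F k in sequentially. ennreal (d powr (- lam)) * ?I k \<le> e"
    using e by (simp add: ennreal_tendsto_zero_iff)
  then show "\<forall>\<^sub>F k in sequentially. \<forall>x. \<forall>r\<ge>d. morrey_M p lam (u k) x r \<le> e"
  proof eventually_elim
    case (elim k)
    have "morrey_M p lam (u k) x r \<le> ennreal (d powr (- lam)) * ?I k" if "d \<le> r" for x r
      by (rule order.trans[OF morrey_M_le_nn_integral[OF lam d that]])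
        (intro mult_left_mono nn_integral_mono, auto simp: indicator_def)
    with elim show ?case
      using order.trans by blast
  qed
qed

section \<open>Closures in the Morrey norm\<close>

definition morrey_closure :: "real \<Rightarrow> real \<Rightarrow> ('a::euclidean_space \<Rightarrow> real) set \<Rightarrow> ('a \<Rightarrow> real) set" where
  "morrey_closure p lam A = {f \<in> borel_measurable lebesgue. \<forall>e>0. \<exists>g\<in>A. morrey_sup p lam (f - g) \<le> e}"

lemma subset_morrey_closure:
  assumes "A \<subseteq> borel_measurable lebesgue"
  shows "A \<subseteq> morrey_closure p lam A"
proof
  fix f
  assume "f \<in> A"
  moreover have "morrey_sup p lam (f - f) = 0"
    by (simp add: fun_diff_def morrey_sup_zero)
  ultimately show "f \<in> morrey_closure p lam A"
    unfolding morrey_closure_def using assms by force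
qed

lemma morrey_closure_limit:
  assumes p: "0 \<le> p" and A: "A \<subseteq> borel_measurable lebesgue" and f: "f \<in> borel_measurable lebesgue"
    and h: "\<And>k. h k \<in> morrey_closure p lam A"
    and lim: "((\<lambda>k. morrey_sup p lam (f - h k)) \<longlongrightarrow> 0) F" "F \<noteq> bot"
  shows "f \<in> morrey_closure p lam A"
  unfolding morrey_closure_def
proof (intro CollectI conjI allI impI f)
  fix e :: ennreal
  assume e: "0 < e"
  define C where "C = ennreal (2 powr p)"
  define d where "d = e / (C * 2)"
  have C: "0 < C" "C < top"
    by (simp_all add: C_def)
  then have d: "0 < d"
    using e by (simp add: d_def ennreal_zero_less_divide ennreal_mult_less_top)
  then have "\<forall>\<^sub>F k in F. morrey_sup p lam (f - h k) \<le> d"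
    using lim(1) by (simp add: ennreal_tendsto_zero_iff)
  then obtain k where k: "morrey_sup p lam (f - h k) \<le> d"
    using eventually_happens'[OF lim(2)] by blast
  obtain g where g: "g \<in> A" "morrey_sup p lam (h k - g) \<le> d"
    using h d by (auto simp: morrey_closure_def)
  have "morrey_sup p lam (f - g) \<le> C * (morrey_sup p lam (f - h k) + morrey_sup p lam (h k - g))"
    unfolding C_def using f h A g(1) by (intro morrey_sup_quasi_triangle p) (auto simp: morrey_closure_def)
  also have "\<dots> \<le> C * (d + d)"
    by (intro mult_left_mono add_mono k g(2)) simp
  also have "\<dots> = (C * 2) * (e / (C * 2))"
    unfolding d_def by (simp add: mult_2[symmetric] mult.assoc)
  also have "\<dots> = e"
    using C by (simp add: ennreal_times_divide mult_divide_eq_ennreal mult.commute ennreal_mult_eq_top_iff)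
  finally show "\<exists>g\<in>A. morrey_sup p lam (f - g) \<le> e"
    using g(1) by blast
qed

lemma morrey_closure_approximation:
  assumes p: "0 < p" and A: "A \<subseteq> borel_measurable lebesgue" and f: "f \<in> morrey_closure p lam A" and \<epsilon>: "0 < \<epsilon>"
  shows "\<exists>g\<in>A. f - g \<in> morrey_space p lam \<and> morrey_norm p lam (f - g) < \<epsilon>"
proof -
  have "0 < ennreal ((\<epsilon> / 2) powr p)"
    using \<epsilon> by simp
  then obtain g where g: "g \<in> A" and half: "morrey_sup p lam (f - g) \<le> ennreal ((\<epsilon> / 2) powr p)"
    using f unfolding morrey_closure_def by blast
  have less: "morrey_sup p lam (f - g) < ennreal (\<epsilon> powr p)"
    by (rule le_less_trans[OF half]) (use \<epsilon> p in \<open>simp add: ennreal_lessI powr_less_mono2\<close>)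
  have "f - g \<in> borel_measurable lebesgue"
    using f A g by (auto simp: fun_diff_def morrey_closure_def)
  then have "f - g \<in> morrey_space p lam"
    using less_trans[OF less ennreal_less_top] by (simp add: morrey_spaceI)
  with g morrey_norm_less[OF p \<epsilon> less] show ?thesis
    by blast
qed

lemma morrey_closure_dominated_limit:
  fixes f :: "'a::euclidean_space \<Rightarrow> real" and h :: "nat \<Rightarrow> 'a \<Rightarrow> real"
  assumes lam: "0 \<le> lam" and p: "0 < p" and A: "A \<subseteq> borel_measurable lebesgue"
    and f: "f \<in> borel_measurable lebesgue" and h: "\<And>k. h k \<in> morrey_closure p lam A"
    and w: "w \<in> borel_measurable lebesgue" "morrey_vanishing p lam (at_right 0) w"
      "(\<integral>\<^sup>+ y. ennreal (\<bar>w y\<bar> powr p) \<partial>lebesgue) < \<infinity>"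
    and dominated: "\<And>k y. \<bar>f y - h k y\<bar> \<le> \<bar>w y\<bar>"
    and lim: "AE y in lebesgue. (\<lambda>k. h k y) \<longlonglongrightarrow> f y"
  shows "f \<in> morrey_closure p lam A"
proof (rule morrey_closure_limit[OF less_imp_le[OF p] A f h])
  have "AE y in lebesgue. (\<lambda>k. (f - h k) y) \<longlonglongrightarrow> 0"
    using lim
  proof eventually_elim
    case (elim y)
    then show ?case
      using tendsto_diff[OF tendsto_const elim, of "f y"] by simp
  qed
  moreover have "f - h k \<in> borel_measurable lebesgue" for k
    using f h unfolding fun_diff_def by (intro borel_measurable_diff) (auto simp: morrey_closure_def)
  ultimately show "(\<lambda>k. morrey_sup p lam (f - h k)) \<longlonglongrightarrow> 0"
    using dominated by (intro morrey_sup_dominated_convergence[OF lam p _ w]) auto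
qed simp

lemma nn_integral_powr_indicator_bounded_finite:
  fixes B :: "'a::euclidean_space set" and c :: real
  assumes "B \<in> sets lborel" "bounded B"
  shows "(\<integral>\<^sup>+ x. ennreal (\<bar>c * indicator B x\<bar> powr p) \<partial>lebesgue) < \<infinity>"
proof -
  have "(\<integral>\<^sup>+ x. ennreal (\<bar>c * indicator B x\<bar> powr p) \<partial>lebesgue)
      = (\<integral>\<^sup>+ x. ennreal (\<bar>c\<bar> powr p) * indicator B x \<partial>lborel)"
    unfolding nn_integral_completion by (intro nn_integral_cong) (auto simp: indicator_def)
  also have "\<dots> < \<infinity>"
    using assms emeasure_bounded_finite[OF assms(2)]
    by (simp add: nn_integral_cmult_indicator ennreal_mult_less_top)
  finally show ?thesis .
qed

lemma bump_mult_bounded_in_morrey_closure: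
  fixes k :: "'a::euclidean_space \<Rightarrow> real"
  assumes lam: "0 \<le> lam" "lam < real DIM('a)" and p: "0 < p" and R: "0 \<le> R"
    and k: "k \<in> borel_measurable lebesgue" "\<And>x. \<bar>k x\<bar> \<le> M"
  shows "(\<lambda>x. bump a R x * k x) \<in> morrey_closure p lam C0_inf"
proof -
  obtain P :: "nat \<Rightarrow> 'a \<Rightarrow> real" where P: "\<And>n. real_polynomial_function (P n)"
    and P_le: "\<And>n x. x \<in> cball a R \<Longrightarrow> \<bar>P n x\<bar> \<le> M + 1"
    and P_lim: "AE x in lebesgue. x \<in> cball a R \<longrightarrow> (\<lambda>n. P n x) \<longlonglongrightarrow> k x"
    using bounded_measurable_AE_limit_polynomials[OF k compact_cball] by blast
  let ?w = "\<lambda>x. (2 * M + 1) * indicator (ball a R) x :: real"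
  have approximant_in_C0_inf: "(\<lambda>x. bump a R x * P n x) \<in> C0_inf" for n
    by (intro bump_mult_in_C0_inf Cinf_real_polynomial_function P R)
  show ?thesis
  proof (rule morrey_closure_dominated_limit[OF lam(1) p C0_inf_measurable, where w = ?w])
    show "(\<lambda>x. bump a R x * P n x) \<in> morrey_closure p lam C0_inf" for n
      using approximant_in_C0_inf subset_morrey_closure[OF C0_inf_measurable] by blast
    show "morrey_vanishing p lam (at_right 0) ?w"
      by (rule morrey_vanishing_mono[OF morrey_vanishing_const[OF lam(2), of p "2 * M + 1"]])
        (use p in \<open>auto simp: indicator_def\<close>)
    show "(\<integral>\<^sup>+ x. ennreal (\<bar>?w x\<bar> powr p) \<partial>lebesgue) < \<infinity>"
      by (rule nn_integral_powr_indicator_bounded_finite) simp_all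
    show "\<bar>bump a R x * k x - bump a R x * P n x\<bar> \<le> \<bar>?w x\<bar>" for n x
      unfolding right_diff_distrib[symmetric]
      by (rule abs_bump_mult_le[OF R]) (use P_le[of x n] k(2)[of x] in auto)
    show "AE x in lebesgue. (\<lambda>n. bump a R x * P n x) \<longlonglongrightarrow> bump a R x * k x"
      using P_lim by eventually_elim (rule tendsto_bump_mult[OF R], simp)
  qed (use k(1) in measurable)
qed

text \<open>Truncating the quotient of \<open>f\<close> by a bump function, rather than \<open>f\<close> itself, keeps every
  approximant a bump function times a bounded factor.\<close>
lemma restrict_ball_in_morrey_closure:
  fixes f :: "'a::euclidean_space \<Rightarrow> real"
  assumes lam: "0 \<le> lam" "lam < real DIM('a)" and p: "0 < p" and R: "0 \<le> R"
    and f: "f \<in> borel_measurable lebesgue" "morrey_vanishing p lam (at_right 0) f"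
      "(\<integral>\<^sup>+ y \<in> ball a R. ennreal (\<bar>f y\<bar> powr p) \<partial>lebesgue) < \<infinity>"
  shows "(\<lambda>y. f y * indicator (ball a R) y) \<in> morrey_closure p lam C0_inf"
proof -
  let ?f = "\<lambda>y. f y * indicator (ball a R) y"
  let ?h = "\<lambda>n y. bump a R y * truncate_at (real n) (f y / bump a R y)"
  have f_eq: "?f y = bump a R y * (f y / bump a R y)" for y
    using bump_eq_0_iff[OF R, of a y] by (simp add: indicator_def)
  have f_measurable: "?f \<in> borel_measurable lebesgue"
    using f(1) by measurable
  have quotient_measurable: "(\<lambda>y. f y / bump a R y) \<in> borel_measurable lebesgue"
    using f(1) by measurable
  show ?thesis
  proof (rule morrey_closure_dominated_limit[OF lam(1) p C0_inf_measurable f_measurable, where w = ?f])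
    show "?h n \<in> morrey_closure p lam C0_inf" for n
      using quotient_measurable unfolding truncate_at_def
      by (intro bump_mult_bounded_in_morrey_closure[OF lam p R, where M = "real n"]) auto
    show "morrey_vanishing p lam (at_right 0) ?f"
      by (rule morrey_vanishing_mono[OF f(2)]) (use p in \<open>auto simp: indicator_def\<close>)
    have "(\<integral>\<^sup>+ y. ennreal (\<bar>?f y\<bar> powr p) \<partial>lebesgue) = (\<integral>\<^sup>+ y \<in> ball a R. ennreal (\<bar>f y\<bar> powr p) \<partial>lebesgue)"
      by (intro nn_integral_cong) (simp add: indicator_def)
    with f(3) show "(\<integral>\<^sup>+ y. ennreal (\<bar>?f y\<bar> powr p) \<partial>lebesgue) < \<infinity>"
      by simp
    show "\<bar>?f y - ?h n y\<bar> \<le> \<bar>?f y\<bar>" for n y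
      unfolding f_eq right_diff_distrib[symmetric] abs_mult
      by (intro mult_left_mono abs_diff_truncate_at_le) simp_all
    show "AE y in lebesgue. (\<lambda>n. ?h n y) \<longlonglongrightarrow> ?f y"
      unfolding f_eq by (intro AE_I2 tendsto_mult_left truncate_at_tendsto_id)
  qed (rule f_measurable)
qed

lemma V0inf_star_morreyD:
  assumes "f \<in> V0inf_star_morrey p lam"
  shows "f \<in> borel_measurable lebesgue"
    and "compact K \<Longrightarrow> (\<integral>\<^sup>+ y \<in> K. ennreal (\<bar>f y\<bar> powr p) \<partial>lebesgue) < \<infinity>"
    and "morrey_vanishing p lam (at_right 0) f" "morrey_vanishing p lam at_top f"
    and "(\<lambda>N::nat. SUP x. \<integral>\<^sup>+ y \<in> ball x 1.
          ennreal (\<bar>f y\<bar> powr p) * indicator (- ball 0 (real N)) y \<partial>lebesgue) \<longlonglongrightarrow> 0"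
  using assms
  by (simp_all add: V0inf_star_morrey_def V0_morrey_def Vinf_morrey_def Vstar_morrey_def morrey_space_def
      Lp_loc_def morrey_vanishing_def nn_integral_completion)

lemma V0inf_star_morrey_subset_closure:
  fixes lam :: real
  assumes lam: "0 \<le> lam" "lam < real DIM('a::euclidean_space)" and p: "0 < p"
  shows "V0inf_star_morrey p lam \<subseteq> morrey_closure p lam (C0_inf :: ('a \<Rightarrow> real) set)"
proof
  fix f :: "'a \<Rightarrow> real"
  assume "f \<in> V0inf_star_morrey p lam"
  note f = V0inf_star_morreyD[OF this]
  let ?h = "\<lambda>(N::nat) y. f y * indicator (ball 0 (real N)) y"
  let ?tail = "\<lambda>(N::nat) y. f y * indicator (- ball 0 (real N)) y"
  show "f \<in> morrey_closure p lam C0_inf"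
  proof (rule morrey_closure_limit[OF less_imp_le[OF p] C0_inf_measurable f(1)])
    fix N :: nat
    have "(\<integral>\<^sup>+ y \<in> ball 0 (real N). ennreal (\<bar>f y\<bar> powr p) \<partial>lebesgue)
        \<le> (\<integral>\<^sup>+ y \<in> cball 0 (real N). ennreal (\<bar>f y\<bar> powr p) \<partial>lebesgue)"
      by (intro nn_integral_mono) (auto simp: indicator_def)
    also have "\<dots> < \<infinity>"
      by (rule f(2)) simp
    finally show "?h N \<in> morrey_closure p lam C0_inf"
      by (intro restrict_ball_in_morrey_closure lam p f(1,3)) simp_all
  next
    have "f - ?h N = ?tail N" for N
      by (auto simp: fun_eq_iff indicator_def)
    moreover have "(\<lambda>N. morrey_sup p lam (?tail N)) \<longlonglongrightarrow> 0"
    proof (rule morrey_sup_tendsto_0_uniformly_local[OF lam(1) less_imp_le[OF p] zero_less_one f(3,4)])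
      have "ennreal (\<bar>?tail N y\<bar> powr p) = ennreal (\<bar>f y\<bar> powr p) * indicator (- ball 0 (real N)) y" for N y
        by (simp add: indicator_def)
      with f(5) show "(\<lambda>N. SUP x. \<integral>\<^sup>+ y \<in> ball x 1. ennreal (\<bar>?tail N y\<bar> powr p) \<partial>lebesgue) \<longlonglongrightarrow> 0"
        by simp
      show "?tail N \<in> borel_measurable lebesgue" for N
        by (intro borel_measurable_times borel_measurable_indicator f(1)) auto
    qed (auto simp: indicator_def)
    ultimately show "(\<lambda>N. morrey_sup p lam (f - ?h N)) \<longlonglongrightarrow> 0"
      by simp
  qed simp
qed

theorem theorem5p3:
  fixes f :: "'n::euclidean_space \<Rightarrow> real" and p lam :: real
  assumes "0 \<le> lam" "lam < real DIM('n)" "1 \<le> p"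
    and "f \<in> V0inf_star_morrey p lam"
  shows "\<forall>\<epsilon>>0. \<exists>g \<in> C0_inf. f - g \<in> morrey_space p lam \<and> morrey_norm p lam (f - g) < \<epsilon>"
proof -
  have p: "0 < p"
    using assms(3) by simp
  have "f \<in> morrey_closure p lam C0_inf"
    using V0inf_star_morrey_subset_closure[OF assms(1,2) p] assms(4) by (rule subsetD)
  from morrey_closure_approximation[OF p C0_inf_measurable this] show ?thesis
    by blast
qed

end
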